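(* Let $G=(V,E)$ be a graph with $n$ vertices and $m$ edges, and let $H$ be a graph on $k$ vertices (the pattern) that contains a $t$-clique as a subgraph. Then one can construct, in $O(k^2m+kn)$ time, a graph $G^*$ on at most $nk$ vertices such that $G^*$ contains a (not necessarily induced) subgraph isomorphic to $H$ if and only if $G$ contains a $t$-clique.
   Context: A (not necessarily induced) subgraph of $G^*$ isomorphic to $H$ means an injective map $f:V(H)\to V(G^* )$ such that $(u,v)\in E(H)$ implies $(f(u),f(v))\in E(G^* )$. A $t$-clique is a set of $t$ pairwise adjacent vertices.
   Formalization: H and t are fixed (one algorithm per H, t; constant uniform), t ≥ 1 is assumed, and the time bound gets an extra k² if t = 1, else an extra 1: for t = 1, G = K_1, H = K_k, writing G* takes order k² steps, not O(k); for t = 0, n = 0 no G* exists. *)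

theory Defs
  imports "Graph_Theory.Pair_Digraph"
begin

text \<open>
  Finite simple undirected graphs are the structures of the library locale \<^locale>\<open>pair_graph\<close>:
  finite, loop-free and symmetric, so every undirected edge occurs in \<^const>\<open>parcs\<close> as two
  opposite pairs.
\<close>

definition num_edges :: "'a pair_pre_digraph \<Rightarrow> nat" where
  "num_edges G = card ((\<lambda>(u, v). {u, v}) ` parcs G)"

definition is_clique :: "'a pair_pre_digraph \<Rightarrow> 'a set \<Rightarrow> bool" where
  "is_clique G S \<longleftrightarrow> S \<subseteq> pverts G \<and> (\<forall>u\<in>S. \<forall>v\<in>S. u \<noteq> v \<longrightarrow> (u, v) \<in> parcs G)"

definition has_clique :: "'a pair_pre_digraph \<Rightarrow> nat \<Rightarrow> bool" where
  "has_clique G t \<longleftrightarrow> (\<exists>S. is_clique G S \<and> finite S \<and> card S = t)"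

definition contains_subgraph :: "'a pair_pre_digraph \<Rightarrow> 'b pair_pre_digraph \<Rightarrow> bool" where
  "contains_subgraph G H \<longleftrightarrow>
     (\<exists>f. f \<in> pverts H \<rightarrow> pverts G \<and> inj_on f (pverts H) \<and>
          (\<forall>(u, v) \<in> parcs H. (f u, f v) \<in> parcs G))"

section \<open>Running time\<close>

text \<open>
  Running time is measured on a unit-cost random access machine over the natural numbers: registers,
  a memory with indirect addressing, constants, addition and truncated subtraction (no
  multiplication). Programs are structured; every elementary instruction and every test of a
  conditional or loop costs one step.
\<close>

record ram_state =
  reg :: "nat \<Rightarrow> nat"
  mem :: "nat \<Rightarrow> nat"

datatype ram_prog =
    RSkip
  | RConst nat nat
  | RAdd nat nat nat
  | RSub nat nat nat
  | RLoad nat nat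
  | RStore nat nat
  | RSeq ram_prog ram_prog
  | RIf nat ram_prog ram_prog
  | RWhile nat ram_prog

text \<open>\<open>ram_exec P s T s'\<close>: started in \<open>s\<close>, the program \<open>P\<close> halts in \<open>s'\<close> after exactly \<open>T\<close> steps.\<close>

inductive ram_exec :: "ram_prog \<Rightarrow> ram_state \<Rightarrow> nat \<Rightarrow> ram_state \<Rightarrow> bool" where
  Skip: "ram_exec RSkip s 1 s"
| Const: "ram_exec (RConst r a) s 1 (s\<lparr>reg := (reg s)(r := a)\<rparr>)"
| Add: "ram_exec (RAdd r p q) s 1 (s\<lparr>reg := (reg s)(r := reg s p + reg s q)\<rparr>)"
| Sub: "ram_exec (RSub r p q) s 1 (s\<lparr>reg := (reg s)(r := reg s p - reg s q)\<rparr>)"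
| Load: "ram_exec (RLoad r p) s 1 (s\<lparr>reg := (reg s)(r := mem s (reg s p))\<rparr>)"
| Store: "ram_exec (RStore p r) s 1 (s\<lparr>mem := (mem s)(reg s p := reg s r)\<rparr>)"
| Seq: "ram_exec P s T1 s' \<Longrightarrow> ram_exec Q s' T2 s'' \<Longrightarrow> ram_exec (RSeq P Q) s (T1 + T2) s''"
| IfNonzero: "reg s r \<noteq> 0 \<Longrightarrow> ram_exec P s T s' \<Longrightarrow> ram_exec (RIf r P Q) s (1 + T) s'"
| IfZero: "reg s r = 0 \<Longrightarrow> ram_exec Q s T s' \<Longrightarrow> ram_exec (RIf r P Q) s (1 + T) s'"
| WhileZero: "reg s r = 0 \<Longrightarrow> ram_exec (RWhile r P) s 1 s"
| WhileNonzero: "reg s r \<noteq> 0 \<Longrightarrow> ram_exec P s T1 s' \<Longrightarrow> ram_exec (RWhile r P) s' T2 s'' \<Longrightarrow>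
    ram_exec (RWhile r P) s (1 + T1 + T2) s''"

text \<open>
  A run is unique, so asserting that a run with some property exists is a statement about
  the run of the program.
\<close>

lemma ram_exec_deterministic:
  "ram_exec P s T s' \<Longrightarrow> ram_exec P s U u' \<Longrightarrow> U = T \<and> u' = s'"
proof (induction arbitrary: U u' rule: ram_exec.induct)
  case (Seq P s T1 s' Q T2 s'')
  from Seq.prems show ?case by cases (use Seq.IH in blast)
next
  case (WhileNonzero s r P T1 s' T2 s'')
  from WhileNonzero.prems show ?case
    by cases (use WhileNonzero.IH WhileNonzero.hyps in blast)+
next
  case (IfNonzero s r P T s' Q)
  from IfNonzero.prems show ?case
    by cases (use IfNonzero.IH IfNonzero.hyps in blast)+
next
  case (IfZero s r Q T s' P)
  from IfZero.prems show ?case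
    by cases (use IfZero.IH IfZero.hyps in blast)+
qed (auto elim: ram_exec.cases)

definition ram_init :: "nat list \<Rightarrow> ram_state" where
  "ram_init xs = \<lparr>reg = (\<lambda>_. 0), mem = (\<lambda>i. if i < length xs then xs ! i else 0)\<rparr>"

text \<open>The output is written to memory; register 0 holds its start address.\<close>

definition ram_output :: "ram_state \<Rightarrow> nat list \<Rightarrow> bool" where
  "ram_output s ys \<longleftrightarrow> (\<forall>i < length ys. mem s (reg s 0 + i) = ys ! i)"

text \<open>
  A graph is stored as its number of vertices, its number of edges and the list of its edges, where
  the vertices are numbered in an arbitrary way. The condition on the length of
  the list says that every edge is listed exactly once, in one of its two orientations.
\<close>

definition encodes :: "nat list \<Rightarrow> 'a pair_pre_digraph \<Rightarrow> bool" where
  "encodes xs G \<longleftrightarrow>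
     (\<exists>f es. bij_betw f (pverts G) {..<card (pverts G)} \<and>
        (\<lambda>(u, v). (f u, f v)) ` parcs G = set es \<union> (set es)\<inverse> \<and>
        length es = num_edges G \<and>
        xs = card (pverts G) # length es # concat (map (\<lambda>(a, b). [a, b]) es))"

text \<open>
  The bound on the running time, up to a constant factor, for a host graph with \<open>n\<close> vertices and
  \<open>m\<close> edges and a pattern with \<open>k\<close> vertices. The last summand only matters in degenerate
  cases. If \<open>t \<ge> 2\<close>, then \<open>1\<close> is absorbed by \<open>k * n\<close> unless \<open>n = 0\<close>, where no program halts in zero
  steps. If \<open>t = 1\<close>, the bound \<open>k\<^sup>2 * m + k * n\<close> is unattainable: for the one-vertex
  graph and the complete pattern on \<open>k\<close> vertices the output has to be this complete graph, whose
  encoding has length quadratic in \<open>k\<close>; hence the additional \<open>k\<^sup>2\<close>, which is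
  absorbed by \<open>k\<^sup>2 * m\<close> as soon as \<open>m > 0\<close>.
\<close>

definition time_bound :: "nat \<Rightarrow> nat \<Rightarrow> nat \<Rightarrow> nat \<Rightarrow> nat" where
  "time_bound t n m k = k\<^sup>2 * m + k * n + (if t = 1 then k\<^sup>2 else 1)"

end

theory Submission
  imports Defs
begin

text \<open>
  Cover the \<open>t\<close>-cliques of \<open>H\<close> by as few \<open>t\<close>-colourable vertex sets as possible and let \<open>C\<close> be one of
  these sets. Take \<open>V(G) \<times> V(H)\<close> as vertex set of \<open>G\<^sup>*\<close> and join \<open>(x, u)\<close> to \<open>(y, v)\<close> if \<open>uv\<close> is an edge
  of \<open>H\<close> and \<open>xy\<close> is an edge of \<open>G\<close>; if \<open>u\<close> and \<open>v\<close> are not both in \<open>C\<close>, also \<open>x = y\<close> is allowed.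
  A \<open>t\<close>-clique of \<open>G\<close> yields a copy of \<open>H\<close>: put \<open>u \<in> C\<close> over the clique vertex given by the colour of
  \<open>u\<close>, and everything else over one fixed clique vertex. Conversely a copy of \<open>H\<close> in \<open>G\<^sup>*\<close> projects to
  an endomorphism of \<open>H\<close>. By minimality this maps some \<open>t\<close>-clique into \<open>C\<close>, and over \<open>C\<close> the
  projection to \<open>G\<close> preserves edges, so this clique projects to a \<open>t\<close>-clique of \<open>G\<close>.
\<close>

section \<open>Running programs\<close>

text \<open>A postcondition on time and final state, in the style of weakest preconditions. As runs
  are unique, the existential form loses nothing. The rules for all constructs but loops are
  equivalences, so the simplifier executes loop-free code symbolically.\<close>

definition runs :: "ram_prog \<Rightarrow> ram_state \<Rightarrow> (nat \<Rightarrow> ram_state \<Rightarrow> bool) \<Rightarrow> bool" where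
  "runs P s Q \<longleftrightarrow> (\<exists>T s'. ram_exec P s T s' \<and> Q T s')"

lemma runs_mono: "runs P s Q \<Longrightarrow> (\<And>T s'. Q T s' \<Longrightarrow> R T s') \<Longrightarrow> runs P s R"
  by (auto simp: runs_def)

lemma runs_eqI: "ram_exec P s T s' \<Longrightarrow> runs P s Q \<longleftrightarrow> Q T s'"
  by (auto simp: runs_def dest: ram_exec_deterministic)

lemma runs_atomic [simp]:
  "runs RSkip s Q \<longleftrightarrow> Q 1 s"
  "runs (RConst r a) s Q \<longleftrightarrow> Q 1 (s\<lparr>reg := (reg s)(r := a)\<rparr>)"
  "runs (RAdd r p q) s Q \<longleftrightarrow> Q 1 (s\<lparr>reg := (reg s)(r := reg s p + reg s q)\<rparr>)"
  "runs (RSub r p q) s Q \<longleftrightarrow> Q 1 (s\<lparr>reg := (reg s)(r := reg s p - reg s q)\<rparr>)"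
  "runs (RLoad r p) s Q \<longleftrightarrow> Q 1 (s\<lparr>reg := (reg s)(r := mem s (reg s p))\<rparr>)"
  "runs (RStore p r) s Q \<longleftrightarrow> Q 1 (s\<lparr>mem := (mem s)(reg s p := reg s r)\<rparr>)"
  by (rule runs_eqI, rule ram_exec.intros)+

inductive_cases ram_exec_RSeqE: "ram_exec (RSeq P P') s T s'"
inductive_cases ram_exec_RIfE: "ram_exec (RIf r P P') s T s'"

lemma runs_RSeq [simp]:
  "runs (RSeq P P') s Q \<longleftrightarrow> runs P s (\<lambda>T s'. runs P' s' (\<lambda>T' s''. Q (T + T') s''))"
proof -
  have "ram_exec (RSeq P P') s T s' \<longleftrightarrow>
      (\<exists>T1 s1 T2. T = T1 + T2 \<and> ram_exec P s T1 s1 \<and> ram_exec P' s1 T2 s')" for T s'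
    by (auto intro: ram_exec.Seq elim!: ram_exec_RSeqE)
  then show ?thesis by (simp add: runs_def) blast
qed

lemma runs_RIf [simp]:
  "runs (RIf r P P') s Q \<longleftrightarrow>
    (if reg s r \<noteq> 0 then runs P s (\<lambda>T. Q (1 + T)) else runs P' s (\<lambda>T. Q (1 + T)))"
proof -
  have "ram_exec (RIf r P P') s T s' \<longleftrightarrow>
      (\<exists>T'. T = 1 + T' \<and> ram_exec (if reg s r \<noteq> 0 then P else P') s T' s')" for T s'
    using ram_exec.IfZero[of s r P' _ s' P] ram_exec.IfNonzero[of s r P _ s' P']
    by (auto elim!: ram_exec_RIfE)
  then show ?thesis by (auto simp: runs_def)
qed

text \<open>The invariant is indexed by the number of completed rounds. Each of the \<open>m\<close>
  rounds pays for its body and one test; the last, failing test adds one step.\<close>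

lemma runs_RWhile:
  assumes step: "\<And>i s. i < m \<Longrightarrow> I i s \<Longrightarrow>
      reg s r \<noteq> 0 \<and> runs P s (\<lambda>T s'. T \<le> B \<and> I (Suc i) s')"
    and stop: "\<And>s. I m s \<Longrightarrow> reg s r = 0"
    and init: "I 0 s"
  shows "runs (RWhile r P) s (\<lambda>T s'. T \<le> m * (B + 1) + 1 \<and> I m s')"
proof -
  \<comment> \<open>Induction on the number \<open>j\<close> of rounds still to come, because the
    loop rule peels off the first round.\<close>
  have "\<exists>T s'. ram_exec (RWhile r P) s T s' \<and> T \<le> j * (B + 1) + 1 \<and> I m s'"
    if "j \<le> m" "I (m - j) s" for j s
    using that
  proof (induction j arbitrary: s)
    case 0
    then have "ram_exec (RWhile r P) s 1 s" by (intro WhileZero stop) simp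
    with 0 show ?case by (intro exI[of _ 1] exI[of _ s]) simp
  next
    case (Suc j)
    obtain T1 s1 where 1: "ram_exec P s T1 s1" "T1 \<le> B" "I (Suc (m - Suc j)) s1"
        and nz: "reg s r \<noteq> 0"
      using step[of "m - Suc j" s] Suc.prems by (auto simp: runs_def)
    have "Suc (m - Suc j) = m - j" using Suc.prems by simp
    with 1 Suc.IH[of s1] Suc.prems obtain T2 s2
      where "ram_exec (RWhile r P) s1 T2 s2" "T2 \<le> j * (B + 1) + 1" "I m s2"
      by auto
    from WhileNonzero[OF nz 1(1) this(1)] this(2,3) 1(2) show ?case
      by (intro exI[of _ "1 + T1 + T2"] exI[of _ s2]) simp
  qed
  from this[of m s] init show ?thesis by (auto simp: runs_def)
qed

section \<open>Writing lists to memory\<close>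

text \<open>An overlay on a background memory: output that grows only extends the list, while input
  and marks are tracked in the background.\<close>

definition write_list :: "(nat \<Rightarrow> nat) \<Rightarrow> nat \<Rightarrow> nat list \<Rightarrow> nat \<Rightarrow> nat" where
  "write_list g p xs = (\<lambda>i. if p \<le> i \<and> i < p + length xs then xs ! (i - p) else g i)"

lemma write_list_Nil [simp]: "write_list g p [] = g"
  by (auto simp: write_list_def)

lemma write_list_Cons: "write_list g p (x # xs) = write_list (g(p := x)) (Suc p) xs"
proof
  show "write_list g p (x # xs) i = write_list (g(p := x)) (Suc p) xs i" for i
    by (cases "i \<le> p") (auto simp: write_list_def nth_Cons' Suc_le_eq)
qed

lemma write_list_append:
  "write_list (write_list g p xs) (p + length xs) ys = write_list g p (xs @ ys)"
proof (induction xs arbitrary: g p)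
  case (Cons x xs)
  then show ?case using Cons.IH[of _ "Suc p"] by (simp add: write_list_Cons del: fun_upd_apply)
qed simp

text \<open>Used to set a mark in the background memory when output already lies above it.\<close>

lemma write_list_upd:
  "i < p \<Longrightarrow> (write_list g p xs)(i := x) = write_list (g(i := x)) p xs"
  by (auto simp: write_list_def fun_eq_iff)

text \<open>Hard-wires a list into the program. It serves \<open>t = 1\<close>, where the answer for
  every nonempty host is the pattern itself.\<close>

fun writes :: "nat \<Rightarrow> nat list \<Rightarrow> ram_prog" where
  "writes p [] = RConst 2 0"
| "writes p (x # xs) =
    RSeq (RSeq (RConst 1 p) (RSeq (RConst 2 x) (RStore 1 2))) (writes (Suc p) xs)"

lemma runs_writes: "runs (writes p xs) s (\<lambda>T s'. T = 3 * length xs + 1 \<and> reg s' 0 = reg s 0 \<and>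
    mem s' = write_list (mem s) p xs)"
proof (induction p xs arbitrary: s rule: writes.induct)
  case (2 p x xs)
  show ?case
    by (simp del: fun_upd_apply, rule runs_mono[OF 2]) (auto simp: write_list_Cons fun_upd_def)
qed simp

section \<open>Flat edge lists and the machine code that writes them\<close>

definition flatten :: "(nat \<times> nat) list \<Rightarrow> nat list" where
  "flatten es = concat (map (\<lambda>(a, b). [a, b]) es)"

lemma flatten_simps [simp]:
  "flatten [] = []" "flatten ((a, b) # es) = a # b # flatten es"
  "flatten (xs @ ys) = flatten xs @ flatten ys"
  by (simp_all add: flatten_def)

lemma length_flatten [simp]: "length (flatten es) = 2 * length es"
  by (induction es) auto

lemma nth_flatten:
  "i < length es \<Longrightarrow> flatten es ! (2 * i) = fst (es ! i)"
  "i < length es \<Longrightarrow> flatten es ! Suc (2 * i) = snd (es ! i)"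
proof (induction es arbitrary: i)
  case (Cons e es)
  { case 1 with Cons.IH show ?case by (cases e; cases i) auto }
  { case 2 with Cons.IH show ?case by (cases e; cases i) auto }
qed auto

text \<open>The machine cannot multiply, but \<open>k\<close> is fixed with the pattern, so the
  product is unrolled into \<open>k\<close> additions.\<close>

fun mul_const :: "nat \<Rightarrow> nat \<Rightarrow> nat \<Rightarrow> ram_prog" where
  "mul_const r q 0 = RConst r 0"
| "mul_const r q (Suc k) = RSeq (mul_const r q k) (RAdd r r q)"

lemma runs_mul_const [simp]:
  "r \<noteq> q \<Longrightarrow> runs (mul_const r q k) s Q \<longleftrightarrow> Q (k + 1) (s\<lparr>reg := (reg s)(r := k * reg s q)\<rparr>)"
  by (induction k arbitrary: Q) (simp_all add: add.commute)

definition store_sum :: "nat \<Rightarrow> nat \<Rightarrow> ram_prog" where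
  "store_sum u p = RSeq (RConst 9 u) (RSeq (RAdd 9 9 p) (RSeq (RStore 5 9) (RAdd 5 5 1)))"

lemma runs_store_sum:
  assumes "p \<noteq> 5" "p \<noteq> 9" "reg s 1 = 1"
  shows "runs (store_sum u p) s Q \<longleftrightarrow> Q 4
    \<lparr>reg = (reg s)(5 := Suc (reg s 5), 9 := u + reg s p), mem = (mem s)(reg s 5 := u + reg s p)\<rparr>"
proof -
  have *: "s\<lparr>reg := f, mem := g\<rparr> = \<lparr>reg = f, mem = g\<rparr>" for f g by (cases s) simp
  have four: "Suc (Suc (Suc (Suc 0))) = 4" by simp
  show ?thesis using assms by (simp add: store_sum_def * four fun_upd_twist)
qed

text \<open>The final assignment makes the value of the scratch register 9 independent of the list.\<close>

fun emit :: "nat \<Rightarrow> nat \<Rightarrow> (nat \<times> nat) list \<Rightarrow> ram_prog" where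
  "emit p q [] = RConst 9 0"
| "emit p q ((u, v) # us) =
    RSeq (store_sum u p) (RSeq (store_sum v q) (RSeq (RAdd 6 6 1) (emit p q us)))"

text \<open>A pair costs nine steps: four for each \<open>store_sum\<close> and one for the edge
  counter. The closing assignment to register 9 adds one.\<close>

lemma runs_emit:
  assumes "p \<notin> {5, 6, 9}" "q \<notin> {5, 6, 9}" "reg s 1 = 1"
  shows "runs (emit p q us) s Q \<longleftrightarrow> Q (9 * length us + 1)
    \<lparr>reg = (reg s)(5 := reg s 5 + 2 * length us, 6 := reg s 6 + length us, 9 := 0),
     mem = write_list (mem s) (reg s 5) (flatten (map (\<lambda>(u, v). (u + reg s p, v + reg s q)) us))\<rparr>"
  using assms
proof (induction us arbitrary: s Q)
  case Nil
  have *: "s\<lparr>reg := (reg s)(9 := 0)\<rparr> =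
      \<lparr>reg = (reg s)(5 := reg s 5, 6 := reg s 6, 9 := 0), mem = mem s\<rparr>"
    by (cases s) (auto simp: fun_eq_iff)
  show ?case by (simp only: emit.simps runs_atomic *) (simp del: fun_upd_apply)
next
  case (Cons uv us)
  obtain u v where [simp]: "uv = (u, v)" by (cases uv)
  let ?s = "\<lparr>reg = (reg s)(5 := Suc (Suc (reg s 5)), 9 := v + reg s q, 6 := Suc (reg s 6)),
      mem = (mem s)(reg s 5 := u + reg s p, Suc (reg s 5) := v + reg s q)\<rparr>"
  have regs: "(reg ?s)(5 := reg ?s 5 + 2 * length us, 6 := reg ?s 6 + length us, 9 := 0) =
      (reg s)(5 := reg s 5 + 2 * length (uv # us), 6 := reg s 6 + length (uv # us), 9 := 0)"
    by (simp add: fun_eq_iff)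
  have "runs (emit p q (uv # us)) s Q \<longleftrightarrow> runs (emit p q us) ?s (\<lambda>T. Q (9 + T))"
    using Cons.prems by (simp add: runs_store_sum)
  also have "\<dots> \<longleftrightarrow> Q (9 + (9 * length us + 1))
    \<lparr>reg = (reg ?s)(5 := reg ?s 5 + 2 * length us, 6 := reg ?s 6 + length us, 9 := 0),
     mem = write_list (mem ?s) (reg ?s 5) (flatten (map (\<lambda>(u, v). (u + reg ?s p, v + reg ?s q)) us))\<rparr>"
    using Cons.prems by (intro Cons.IH) auto
  finally have *: "runs (emit p q (uv # us)) s Q \<longleftrightarrow> \<dots>" .
  have r: "reg ?s 5 = Suc (Suc (reg s 5))" "reg ?s p = reg s p" "reg ?s q = reg s q"
      "mem ?s = (mem s)(reg s 5 := u + reg s p, Suc (reg s 5) := v + reg s q)"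
    using Cons.prems by auto
  show ?case
    using *[unfolded regs, unfolded r] by (simp add: write_list_Cons del: fun_upd_apply emit.simps)
qed

section \<open>Covering the cliques of the pattern\<close>

lemma pair_graph_iff:
  "pair_graph G \<longleftrightarrow> finite (pverts G) \<and> parcs G \<subseteq> pverts G \<times> pverts G \<and>
     (\<forall>u v. (u, v) \<in> parcs G \<longrightarrow> u \<noteq> v \<and> (v, u) \<in> parcs G)"
proof
  assume "pair_graph G"
  then interpret pair_graph G .
  show "finite (pverts G) \<and> parcs G \<subseteq> pverts G \<times> pverts G \<and>
      (\<forall>u v. (u, v) \<in> parcs G \<longrightarrow> u \<noteq> v \<and> (v, u) \<in> parcs G)"
    using pair_finite_verts in_arcsD1 in_arcsD2 pair_no_loops arcs_symmetric
    by fastforce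
next
  assume *: "finite (pverts G) \<and> parcs G \<subseteq> pverts G \<times> pverts G \<and>
      (\<forall>u v. (u, v) \<in> parcs G \<longrightarrow> u \<noteq> v \<and> (v, u) \<in> parcs G)"
  then have "finite (parcs G)" by (meson finite_SigmaI finite_subset)
  with * show "pair_graph G"
    by unfold_locales (auto simp: symmetric_def arcs_ends_def arc_to_ends_def intro!: symI)
qed

definition colourable :: "'b pair_pre_digraph \<Rightarrow> nat \<Rightarrow> 'b set \<Rightarrow> bool" where
  "colourable H t S \<longleftrightarrow>
     (\<exists>col. col \<in> S \<rightarrow> {..<t} \<and> (\<forall>u\<in>S. \<forall>v\<in>S. (u, v) \<in> parcs H \<longrightarrow> col u \<noteq> col v))"

definition clique_cover :: "'b pair_pre_digraph \<Rightarrow> nat \<Rightarrow> 'b set set \<Rightarrow> bool" where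
  "clique_cover H t F \<longleftrightarrow> finite F \<and> (\<forall>S\<in>F. S \<subseteq> pverts H \<and> colourable H t S) \<and>
     (\<forall>K. is_clique H K \<and> card K = t \<longrightarrow> (\<exists>S\<in>F. K \<subseteq> S))"

definition hom :: "'b pair_pre_digraph \<Rightarrow> 'a pair_pre_digraph \<Rightarrow> ('b \<Rightarrow> 'a) set" where
  "hom H G = {f \<in> pverts H \<rightarrow> pverts G. \<forall>u v. (u, v) \<in> parcs H \<longrightarrow> (f u, f v) \<in> parcs G}"

lemma is_clique_finite: "pair_graph G \<Longrightarrow> is_clique G K \<Longrightarrow> finite K"
  by (auto simp: pair_graph_iff is_clique_def intro: finite_subset)

text \<open>\<open>G\<close> has no loops, so adjacent vertices have distinct images and the map is
  injective on the clique.\<close>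

lemma clique_image:
  assumes "is_clique H K" and "f \<in> K \<rightarrow> pverts G"
    and "\<And>u v. u \<in> K \<Longrightarrow> v \<in> K \<Longrightarrow> (u, v) \<in> parcs H \<Longrightarrow> (f u, f v) \<in> parcs G"
    and "pair_graph G"
  shows "is_clique G (f ` K)" and "card (f ` K) = card K"
proof -
  show "is_clique G (f ` K)"
    using assms unfolding is_clique_def by (auto simp: image_subset_iff Pi_iff) metis
  have "inj_on f K"
    using assms unfolding is_clique_def inj_on_def by (auto simp: pair_graph_iff) metis
  then show "card (f ` K) = card K" by (rule card_image)
qed

lemma clique_colourable:
  assumes "pair_graph H" and "is_clique H K" and "card K = t"
  shows "colourable H t K"
proof -
  obtain col where "bij_betw col K {..<t}"
    using ex_bij_betw_finite_nat[OF is_clique_finite[OF assms(1,2)]] assms(3)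
    by (auto simp: atLeast0LessThan)
  moreover have "(u, u) \<notin> parcs H" for u using assms(1) by (auto simp: pair_graph_iff)
  ultimately show ?thesis
    unfolding colourable_def
    by (intro exI[of _ col]) (auto simp: bij_betw_def dest: inj_onD)
qed

text \<open>Guarantees that a minimum cover exists: a clique is \<open>t\<close>-colourable because
  its \<open>t\<close> vertices can all get different colours.\<close>

lemma clique_cover_exists:
  assumes "pair_graph H"
  shows "clique_cover H t {K. is_clique H K \<and> card K = t}"
proof -
  have "{K. is_clique H K \<and> card K = t} \<subseteq> Pow (pverts H)"
    by (auto simp: is_clique_def)
  then have "finite {K. is_clique H K \<and> card K = t}"
    using assms by (meson finite_Pow_iff finite_subset pair_graph_iff)
  then show ?thesis
    using clique_colourable[OF assms] by (auto simp: clique_cover_def is_clique_def)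
qed

text \<open>The preimages of the members of a cover under an endomorphism avoiding \<open>C\<close> would form a
  smaller cover, so any member \<open>C\<close> of a minimum cover will do.\<close>

lemma unavoidable_colourable_set:
  fixes H :: "'b pair_pre_digraph"
  assumes H: "pair_graph H" and t: "has_clique H t"
  obtains C where "C \<subseteq> pverts H" and "colourable H t C"
    and "\<And>f. f \<in> hom H H \<Longrightarrow> \<exists>K. is_clique H K \<and> card K = t \<and> f ` K \<subseteq> C"
proof -
  define F where "F = arg_min card (clique_cover H t)"
  have F: "clique_cover H t F"
    unfolding F_def by (rule arg_min_natI) (rule clique_cover_exists[OF H])
  have min: "card F \<le> card F'" if "clique_cover H t F'" for F'
    unfolding F_def using that by (rule arg_min_nat_le)
  \<comment> \<open>A \<open>t\<close>-clique of \<open>H\<close> has to be covered, so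
    \<open>F\<close> is not empty.\<close>
  obtain C where C: "C \<in> F"
    using t F by (auto simp: has_clique_def clique_cover_def)
  have "\<exists>K. is_clique H K \<and> card K = t \<and> f ` K \<subseteq> C" if f: "f \<in> hom H H" for f
  proof (rule ccontr)
    assume avoid: "\<nexists>K. is_clique H K \<and> card K = t \<and> f ` K \<subseteq> C"
    let ?pre = "\<lambda>S. {v \<in> pverts H. f v \<in> S}"
    let ?F' = "?pre ` (F - {C})"
    \<comment> \<open>As \<open>f\<close> preserves edges, a colouring of \<open>S\<close> composed
      with \<open>f\<close> colours the preimage.\<close>
    have "colourable H t (?pre S)" if "S \<in> F" for S
    proof -
      obtain col where "col \<in> S \<rightarrow> {..<t}"
          "\<forall>u\<in>S. \<forall>v\<in>S. (u, v) \<in> parcs H \<longrightarrow> col u \<noteq> col v"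
        using F \<open>S \<in> F\<close> by (auto simp: clique_cover_def colourable_def)
      then show ?thesis
        using f unfolding colourable_def hom_def by (intro exI[of _ "col \<circ> f"]) auto
    qed
    \<comment> \<open>The image of \<open>K\<close> is again a \<open>t\<close>-clique and so lies
      in some member of \<open>F\<close>. This member is not \<open>C\<close>, because
      \<open>f\<close> sends no \<open>t\<close>-clique into \<open>C\<close>.\<close>
    moreover have "\<exists>S\<in>?F'. K \<subseteq> S" if K: "is_clique H K" "card K = t" for K
    proof -
      have KV: "K \<subseteq> pverts H" using K by (simp add: is_clique_def)
      have "is_clique H (f ` K)" "card (f ` K) = t"
        using clique_image[OF K(1), of f H] f KV H K(2) by (auto simp: hom_def)
      then obtain S where "S \<in> F" "f ` K \<subseteq> S"
        using F by (auto simp: clique_cover_def)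
      moreover from this have "S \<noteq> C" using avoid K by blast
      ultimately show ?thesis using KV by (intro bexI[of _ "?pre S"]) auto
    qed
    moreover have "finite F" using F by (simp add: clique_cover_def)
    ultimately have "clique_cover H t ?F'"
      by (auto simp: clique_cover_def)
    from min[OF this] have "card F \<le> card (F - {C})"
      using \<open>finite F\<close> card_image_le[of "F - {C}" ?pre] by simp
    moreover have "card (F - {C}) < card F"
      using \<open>finite F\<close> C by (rule card_Diff1_less)
    ultimately show False by simp
  qed
  with C F show ?thesis by (intro that[of C]) (auto simp: clique_cover_def)
qed

section \<open>The blow-up\<close>

text \<open>Correctness independent of the numbering, which is abstracted to \<open>code\<close>.
  Edges over a single vertex \<open>x\<close> are present only for \<open>x\<close> in
  \<open>D\<close>. It suffices that \<open>D\<close> meets every \<open>t\<close>-clique, since the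
  embedding uses such edges over just one clique vertex.\<close>

lemma blowup_contains_iff:
  fixes G :: "'a pair_pre_digraph" and H :: "'b pair_pre_digraph" and code :: "'a \<times> 'b \<Rightarrow> 'c"
  assumes G: "pair_graph G" and H: "pair_graph H"
    and C: "C \<subseteq> pverts H" "colourable H t C"
      "\<And>f. f \<in> hom H H \<Longrightarrow> \<exists>K. is_clique H K \<and> card K = t \<and> f ` K \<subseteq> C"
    and D: "\<And>X. is_clique G X \<Longrightarrow> card X = t \<Longrightarrow> X \<inter> D \<noteq> {}"
    and verts: "bij_betw code (pverts G \<times> pverts H) (pverts B)"
    and arcs: "\<And>x y u v. \<lbrakk>x \<in> pverts G; y \<in> pverts G; u \<in> pverts H; v \<in> pverts H\<rbrakk> \<Longrightarrow>
      (code (x, u), code (y, v)) \<in> parcs B \<longleftrightarrow>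
      (u, v) \<in> parcs H \<and> ((x, y) \<in> parcs G \<or> x = y \<and> x \<in> D \<and> \<not> (u \<in> C \<and> v \<in> C))"
  shows "contains_subgraph B H \<longleftrightarrow> has_clique G t"
proof
  assume "contains_subgraph B H"
  then obtain f where f: "f \<in> pverts H \<rightarrow> pverts B"
      "\<forall>(u, v)\<in>parcs H. (f u, f v) \<in> parcs B"
    unfolding contains_subgraph_def by blast
  \<comment> \<open>\<open>g\<close> decodes the vertices of the copy; its components are the
    projections to \<open>G\<close> and to \<open>H\<close>.\<close>
  define g where "g = inv_into (pverts G \<times> pverts H) code \<circ> f"
  have g: "g u \<in> pverts G \<times> pverts H" "code (g u) = f u" if "u \<in> pverts H" for u
  proof -
    have "f u \<in> code ` (pverts G \<times> pverts H)"
      using f(1) that verts by (auto simp: bij_betw_def)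
    then show "g u \<in> pverts G \<times> pverts H" "code (g u) = f u"
      unfolding g_def by (simp_all add: inv_into_into f_inv_into_f)
  qed
  have step: "(snd (g u), snd (g v)) \<in> parcs H"
      "snd (g u) \<in> C \<Longrightarrow> snd (g v) \<in> C \<Longrightarrow> (fst (g u), fst (g v)) \<in> parcs G"
    if "(u, v) \<in> parcs H" for u v
  proof -
    have uv: "u \<in> pverts H" "v \<in> pverts H" using that H by (auto simp: pair_graph_iff)
    have "(code (fst (g u), snd (g u)), code (fst (g v), snd (g v))) \<in> parcs B"
      using bspec[OF f(2) that] g(2)[OF uv(1)] g(2)[OF uv(2)] by simp
    moreover have "fst (g u) \<in> pverts G" "fst (g v) \<in> pverts G"
        "snd (g u) \<in> pverts H" "snd (g v) \<in> pverts H"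
      using g(1)[OF uv(1)] g(1)[OF uv(2)] by (auto simp: mem_Times_iff)
    ultimately show "(snd (g u), snd (g v)) \<in> parcs H"
        "snd (g u) \<in> C \<Longrightarrow> snd (g v) \<in> C \<Longrightarrow> (fst (g u), fst (g v)) \<in> parcs G"
      using arcs by blast+
  qed
  \<comment> \<open>Every edge of \<open>B\<close> lies over an edge of \<open>H\<close>, so the
    projection is an endomorphism and sends some \<open>t\<close>-clique into \<open>C\<close>.
    There the other projection preserves edges.\<close>
  have "snd \<circ> g \<in> hom H H"
    using step(1) g(1) by (auto simp: hom_def mem_Times_iff)
  then obtain K where K: "is_clique H K" "card K = t" "(snd \<circ> g) ` K \<subseteq> C"
    using C(3) by blast
  then have "K \<subseteq> pverts H" by (simp add: is_clique_def)
  then have "is_clique G ((fst \<circ> g) ` K)" "card ((fst \<circ> g) ` K) = card K"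
    using clique_image[OF K(1), of "fst \<circ> g" G] K(3) g(1) step(2) G
    by (force simp: mem_Times_iff image_subset_iff)+
  then show "has_clique G t"
    using K(2) is_clique_finite[OF G] unfolding has_clique_def by blast
next
  assume "has_clique G t"
  then obtain X where X: "is_clique G X" "finite X" "card X = t"
    by (auto simp: has_clique_def)
  \<comment> \<open>\<open>x0\<close> will carry all vertices of \<open>H\<close> outside
    \<open>C\<close>; lying in \<open>D\<close> provides the edges over it.\<close>
  obtain x0 where x0: "x0 \<in> X" "x0 \<in> D" using D[OF X(1,3)] by blast
  obtain e where e: "bij_betw e {..<t} X"
    using ex_bij_betw_nat_finite[OF X(2)] X(3) by (auto simp: atLeast0LessThan)
  obtain col where col: "col \<in> C \<rightarrow> {..<t}"
      "\<And>u v. u \<in> C \<Longrightarrow> v \<in> C \<Longrightarrow> (u, v) \<in> parcs H \<Longrightarrow> col u \<noteq> col v"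
    using C(2) by (auto simp: colourable_def)
  define p where "p u = (if u \<in> C then e (col u) else x0)" for u
  have pX: "p u \<in> X" for u
    using e col(1) x0(1) by (auto simp: p_def bij_betw_def Pi_iff)
  have XV: "X \<subseteq> pverts G" using X(1) by (simp add: is_clique_def)
  have pne: "p u \<noteq> p v" if "u \<in> C" "v \<in> C" "(u, v) \<in> parcs H" for u v
  proof -
    have "col u \<in> {..<t}" "col v \<in> {..<t}" using col(1) that by auto
    then show ?thesis
      using that col(2)[OF that] e by (auto simp: p_def bij_betw_def dest: inj_onD)
  qed
  have parc: "(p u, p v) \<in> parcs G \<or> p u = p v \<and> p u \<in> D \<and> \<not> (u \<in> C \<and> v \<in> C)"
    if uv: "(u, v) \<in> parcs H" for u v
  \<comment> \<open>If the positions agree, the colouring excludes that both vertices lie in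
    \<open>C\<close>. One of them then sits over \<open>x0\<close>, hence so does the other.\<close>
  proof (cases "p u = p v")
    case True
    then have "\<not> (u \<in> C \<and> v \<in> C)" using pne uv by blast
    then have "p u = x0" using True by (auto simp: p_def split: if_splits)
    with x0 True \<open>\<not> (u \<in> C \<and> v \<in> C)\<close> show ?thesis by simp
  next
    case False
    then show ?thesis using X(1) pX by (auto simp: is_clique_def)
  qed
  show "contains_subgraph B H"
    unfolding contains_subgraph_def
  proof (intro exI[of _ "\<lambda>u. code (p u, u)"] conjI)
    have in_verts: "(p u, u) \<in> pverts G \<times> pverts H" if "u \<in> pverts H" for u
      using that pX XV by auto
    then show "(\<lambda>u. code (p u, u)) \<in> pverts H \<rightarrow> pverts B"
      using verts by (auto simp: bij_betw_def)
    show "inj_on (\<lambda>u. code (p u, u)) (pverts H)"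
      using in_verts verts unfolding bij_betw_def inj_on_def by blast
    show "\<forall>(u, v)\<in>parcs H. (code (p u, u), code (p v, v)) \<in> parcs B"
      using arcs parc pX XV H by (auto simp: pair_graph_iff subset_iff)
  qed
qed

section \<open>Encodings\<close>

text \<open>The identity serves as numbering. No pair is listed in both orientations, so distinct
  entries are distinct undirected edges and the length of the list is the edge count.\<close>

lemma encodes_edge_list:
  assumes "\<And>a b. (a, b) \<in> set es \<Longrightarrow> a < n \<and> b < n \<and> a \<noteq> b \<and> (b, a) \<notin> set es"
    and "distinct es"
  defines "B \<equiv> \<lparr>pverts = {..<n}, parcs = set es \<union> (set es)\<inverse>\<rparr>"
  shows "pair_graph B" and "encodes (n # length es # flatten es) B"
proof -
  show "pair_graph B"
    using assms(1) by (auto simp: pair_graph_iff B_def)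
  have "(\<lambda>(u, v). {u, v}) ` parcs B = (\<lambda>(u, v). {u, v}) ` set es"
    by (auto simp: B_def)
  moreover have "inj_on (\<lambda>(u, v). {u, v}) (set es)"
    using assms(1) by (auto simp: inj_on_def doubleton_eq_iff)
  ultimately have "num_edges B = length es"
    using assms(2) by (simp add: num_edges_def card_image distinct_card)
  then show "encodes (n # length es # flatten es) B"
    unfolding encodes_def
    by (intro exI[of _ id] exI[of _ es]) (simp add: B_def flatten_def)
qed

lemma numbered_arc:
  assumes "pair_graph G" and "bij_betw f (pverts G) {..<n}"
    and "(a, b) \<in> (\<lambda>(u, v). (f u, f v)) ` parcs G"
  shows "a < n \<and> b < n \<and> a \<noteq> b \<and> (b, a) \<in> (\<lambda>(u, v). (f u, f v)) ` parcs G"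
proof -
  obtain u v where uv: "(u, v) \<in> parcs G" "a = f u" "b = f v" using assms(3) by auto
  then have "u \<in> pverts G" "v \<in> pverts G" "u \<noteq> v" "(v, u) \<in> parcs G"
    using assms(1) by (auto simp: pair_graph_iff)
  then show ?thesis
    using assms(2) uv by (auto simp: bij_betw_def dest: inj_onD intro: rev_image_eqI)
qed

text \<open>The prescribed length does the work: as many undirected edges as list entries means no
  repetition and no edge in both orientations.\<close>

lemma encodesE:
  assumes "encodes xs G" and "pair_graph G"
  obtains f es where "bij_betw f (pverts G) {..<card (pverts G)}"
    and "(\<lambda>(u, v). (f u, f v)) ` parcs G = set es \<union> (set es)\<inverse>"
    and "\<And>a b. (a, b) \<in> set es \<Longrightarrow>
      a < card (pverts G) \<and> b < card (pverts G) \<and> a \<noteq> b \<and> (b, a) \<notin> set es"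
    and "distinct es" and "length es = num_edges G"
    and "xs = card (pverts G) # length es # flatten es"
proof -
  obtain f es where f: "bij_betw f (pverts G) {..<card (pverts G)}"
    and arcs: "(\<lambda>(u, v). (f u, f v)) ` parcs G = set es \<union> (set es)\<inverse>"
    and len: "length es = num_edges G"
    and xs: "xs = card (pverts G) # length es # flatten es"
    using assms(1) by (auto simp: encodes_def flatten_def)
  let ?und = "\<lambda>(u, v). {u, v}"
  have sub: "parcs G \<subseteq> pverts G \<times> pverts G"
    using assms(2) by (simp add: pair_graph_iff)
  have range: "a < card (pverts G) \<and> b < card (pverts G) \<and> a \<noteq> b" if "(a, b) \<in> set es" for a b
    using numbered_arc[OF assms(2) f] that arcs by auto
  have "num_edges G = card ((`) f ` ?und ` parcs G)"
    unfolding num_edges_def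
  proof (rule card_image[symmetric], rule inj_on_subset)
    show "inj_on ((`) f) (Pow (pverts G))"
      using f by (simp add: bij_betw_def inj_on_image_Pow)
  qed (use sub in auto)
  also have "(`) f ` ?und ` parcs G = ?und ` (\<lambda>(u, v). (f u, f v)) ` parcs G"
    by (simp add: image_image split_beta)
  also have "\<dots> = ?und ` set es"
    unfolding arcs by auto
  finally have card: "card (?und ` set es) = length es" using len by simp
  \<comment> \<open>The number of distinct entries lies between the number of undirected edges and
    the length of the list, which agree.\<close>
  then have "card (set es) = length es"
    by (metis List.finite_set card_image_le card_length le_antisym)
  then have "distinct es" by (rule card_distinct)
  have "inj_on ?und (set es)"
    using card \<open>card (set es) = length es\<close> by (intro eq_card_imp_inj_on) auto
  then have "(b, a) \<notin> set es" if "(a, b) \<in> set es" for a b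
    using range[OF that] that unfolding inj_on_def by fastforce
  with that[OF f arcs _ \<open>distinct es\<close> len xs] range show ?thesis by blast
qed

text \<open>Every pattern edge is listed from its smaller to its larger number. This orientation
  later prevents an edge over a single host vertex from being listed in both directions.\<close>

lemma obtain_numbering:
  assumes "pair_graph H"
  obtains h hs where "bij_betw h (pverts H) {..<card (pverts H)}"
    and "(\<lambda>(u, v). (h u, h v)) ` parcs H = set hs \<union> (set hs)\<inverse>"
    and "\<And>u v. (u, v) \<in> set hs \<Longrightarrow> u < v \<and> v < card (pverts H)" and "distinct hs"
proof -
  have fin: "finite (pverts H)" using assms by (simp add: pair_graph_iff)
  obtain h where h: "bij_betw h (pverts H) {..<card (pverts H)}"
    using ex_bij_betw_finite_nat[OF fin] by (auto simp: atLeast0LessThan)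
  define E where "E = (\<lambda>(u, v). (h u, h v)) ` parcs H"
  have "finite (parcs H)"
    using assms by (auto simp: pair_graph_iff intro: finite_subset[OF _ finite_SigmaI])
  then have "finite E" by (simp add: E_def)
  then obtain hs where hs: "set hs = {e \<in> E. fst e < snd e}" "distinct hs"
    using finite_distinct_list[of "{e \<in> E. fst e < snd e}"] by auto
  have mem_hs: "(a, b) \<in> set hs \<longleftrightarrow> (a, b) \<in> E \<and> a < b" for a b
    unfolding hs by simp
  have E: "a \<noteq> b \<and> a < card (pverts H) \<and> b < card (pverts H) \<and> (b, a) \<in> E" if "(a, b) \<in> E" for a b
    using numbered_arc[OF assms h that[unfolded E_def]] by (simp add: E_def)
  have "(a, b) \<in> E \<longleftrightarrow> (a, b) \<in> set hs \<union> (set hs)\<inverse>" for a b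
    using E[of a b] E[of b a] mem_hs[of a b] mem_hs[of b a] nat_neq_iff[of a b] by auto
  then have "E = set hs \<union> (set hs)\<inverse>" by (intro set_eqI) (metis surj_pair)
  moreover have "u < v \<and> v < card (pverts H)" if "(u, v) \<in> set hs" for u v
    using that E[of u v] mem_hs[of u v] by blast
  ultimately show ?thesis
    using that[OF h _ _ hs(2)] unfolding E_def by blast
qed

section \<open>The edge list of the blow-up\<close>

definition copies :: "nat \<Rightarrow> (nat \<times> nat) list \<Rightarrow> nat \<Rightarrow> nat \<Rightarrow> (nat \<times> nat) list" where
  "copies k us a b = map (\<lambda>(u, v). (u + k * a, v + k * b)) us"

text \<open>
  The vertex \<open>(a, u)\<close> has number \<open>u + k * a\<close>. Only first coordinates of listed edges receive a copy of
  \<open>ws\<close>: every clique with at least two vertices contains one of them, and their number is at most the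
  number of edges, which keeps the term \<open>k\<^sup>2 * n\<close> out of the running time.
\<close>

primrec blowup :: "nat \<Rightarrow> (nat \<times> nat) list \<Rightarrow> (nat \<times> nat) list \<Rightarrow> (nat \<times> nat) list \<Rightarrow> nat \<Rightarrow>
    (nat \<times> nat) list" where
  "blowup k us ws es 0 = []"
| "blowup k us ws es (Suc i) = blowup k us ws es i @ copies k us (fst (es ! i)) (snd (es ! i)) @
     (if fst (es ! i) \<in> fst ` set (take i es) then []
      else copies k ws (fst (es ! i)) (fst (es ! i)))"

lemma set_copies: "set (copies k us a b) = {(u + k * a, v + k * b) | u v. (u, v) \<in> set us}"
  by (auto simp: copies_def)

lemma distinct_copies: "distinct us \<Longrightarrow> distinct (copies k us a b)"
  by (auto simp: copies_def distinct_map inj_on_def)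

lemma set_blowup:
  "i \<le> length es \<Longrightarrow> set (blowup k us ws es i) =
    (\<Union>(a, b)\<in>set (take i es). set (copies k us a b)) \<union>
    (\<Union>a\<in>fst ` set (take i es). set (copies k ws a a))"
  by (induction i) (auto simp: take_Suc_conv_app_nth split_beta)

lemma mem_blowup_iff:
  assumes "i \<le> length es"
  shows "(p, q) \<in> set (blowup k us ws es i) \<longleftrightarrow>
    (\<exists>a b u v. p = u + k * a \<and> q = v + k * b \<and>
      ((a, b) \<in> set (take i es) \<and> (u, v) \<in> set us \<or>
       a = b \<and> a \<in> fst ` set (take i es) \<and> (u, v) \<in> set ws))"
proof -
  have "(p, q) \<in> set (blowup k us ws es i) \<longleftrightarrow>
      (\<exists>a b. (a, b) \<in> set (take i es) \<and> (p, q) \<in> set (copies k us a b)) \<or>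
      (\<exists>a. a \<in> fst ` set (take i es) \<and> (p, q) \<in> set (copies k ws a a))"
    using assms by (auto simp: set_blowup)
  then show ?thesis unfolding set_copies by blast
qed

text \<open>Remainder and quotient modulo \<open>k\<close> recover the two coordinates.\<close>

lemma code_eq_iff:
  fixes k :: nat
  shows "u < k \<Longrightarrow> v < k \<Longrightarrow> u + k * a = v + k * b \<longleftrightarrow> u = v \<and> a = b"
  by (metis add.right_neutral div_less div_mult_self2 mod_less mod_mult_self2 not_less_zero)

context
  fixes k n :: nat and us ws es :: "(nat \<times> nat) list"
  assumes es: "\<And>a b. (a, b) \<in> set es \<Longrightarrow> a < n \<and> b < n \<and> a \<noteq> b \<and> (b, a) \<notin> set es"
    and us: "\<And>u v. (u, v) \<in> set us \<Longrightarrow> u < k \<and> v < k"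
    and ws: "\<And>u v. (u, v) \<in> set ws \<Longrightarrow> u < v \<and> v < k"
begin

lemma code_mem_blowup_iff:
  assumes "u < k" "v < k" "i \<le> length es"
  shows "(u + k * a, v + k * b) \<in> set (blowup k us ws es i) \<longleftrightarrow>
    (a, b) \<in> set (take i es) \<and> (u, v) \<in> set us \<or>
    a = b \<and> a \<in> fst ` set (take i es) \<and> (u, v) \<in> set ws"
    (is "?lhs \<longleftrightarrow> ?rhs a b u v")
proof
  assume ?lhs
  then obtain a' b' u' v' where *: "u + k * a = u' + k * a'" "v + k * b = v' + k * b'"
      "?rhs a' b' u' v'"
    unfolding mem_blowup_iff[OF assms(3)] by blast
  then have "u' < k" "v' < k" using us[of u' v'] ws[of u' v'] by auto
  with * assms show "?rhs a b u v" by (simp add: code_eq_iff)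
next
  assume "?rhs a b u v"
  then show ?lhs unfolding mem_blowup_iff[OF assms(3)] by metis
qed

text \<open>A reversed entry over two host vertices would need a host edge listed in both
  orientations; over a single host vertex the pairs from \<open>ws\<close> are increasing.\<close>

lemma mem_blowupD:
  assumes "(p, q) \<in> set (blowup k us ws es (length es))"
  shows "p < k * n \<and> q < k * n \<and> p \<noteq> q \<and> (q, p) \<notin> set (blowup k us ws es (length es))"
proof -
  obtain a b u v where pq: "p = u + k * a" "q = v + k * b" and
    *: "(a, b) \<in> set es \<and> (u, v) \<in> set us \<or> a = b \<and> a \<in> fst ` set es \<and> (u, v) \<in> set ws"
    using assms unfolding mem_blowup_iff[OF order_refl] take_all[OF order_refl] by blast
  have uv: "u < k" "v < k" using * us[of u v] ws[of u v] by auto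
  have ab: "a < n" "b < n" using * es by fastforce+
  have lt: "u' + k * a' < k * n" if "u' < k" "a' < n" for u' a'
  proof -
    have "u' + k * a' < k * Suc a'" using that by simp
    also have "\<dots> \<le> k * n" using that by (intro mult_le_mono2) simp
    finally show ?thesis .
  qed
  have "p \<noteq> q"
    using * es ws uv unfolding pq by (subst code_eq_iff) auto
  moreover have "(q, p) \<notin> set (blowup k us ws es (length es))"
    unfolding pq code_mem_blowup_iff[OF uv(2,1) order_refl] take_all[OF order_refl] using * es[of a b] es[of b a] ws[of u v] ws[of v u]
    by auto
  ultimately show ?thesis
    unfolding pq using lt uv ab by simp
qed

lemma distinct_blowup:
  assumes "distinct es" "distinct us" "distinct ws" "i \<le> length es"
  shows "distinct (blowup k us ws es i)"
  using assms(4)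
proof (induction i)
  case (Suc i)
  obtain a b where ab: "es ! i = (a, b)" by fastforce
  have in_es: "(a, b) \<in> set es" using Suc.prems ab by (metis Suc_le_lessD nth_mem)
  have new: "(a, b) \<notin> set (take i es)"
    using assms(1) Suc.prems ab
    by (metis Suc_le_lessD distinct_take id_take_nth_drop not_distinct_conv_prefix)
  have i: "i \<le> length es" using Suc.prems by simp
  \<comment> \<open>An earlier occurrence would come from the edge \<open>(a, b)\<close>, which is
    new, or require \<open>a = b\<close>.\<close>
  have "e \<notin> set (copies k us a b)" if "e \<in> set (blowup k us ws es i)" for e
  proof
    assume "e \<in> set (copies k us a b)"
    then obtain u v where e: "e = (u + k * a, v + k * b)" "(u, v) \<in> set us"
      by (auto simp: set_copies)
    show False
      using that new es[OF in_es] us[OF e(2)] i by (auto simp: e(1) code_mem_blowup_iff)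
  qed
  \<comment> \<open>Either origin of an earlier occurrence would make \<open>a\<close> the first
    coordinate of an earlier edge.\<close>
  moreover have "e \<notin> set (copies k ws a a)"
    if "a \<notin> fst ` set (take i es)" "e \<in> set (blowup k us ws es i)" for e
  proof
    assume "e \<in> set (copies k ws a a)"
    then obtain u v where e: "e = (u + k * a, v + k * a)" "(u, v) \<in> set ws"
      by (auto simp: set_copies)
    then have "u < k" "v < k" using ws[OF e(2)] by auto
    then show False
      using that i by (force simp: e(1) code_mem_blowup_iff)
  qed
  moreover have "e \<notin> set (copies k ws a a)" if mem: "e \<in> set (copies k us a b)" for e
  proof
    assume "e \<in> set (copies k ws a a)"
    then obtain u v where e: "e = (u + k * a, v + k * a)" "(u, v) \<in> set ws"
      by (auto simp: set_copies)
    obtain u' v' where e': "e = (u' + k * a, v' + k * b)" "(u', v') \<in> set us"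
      using mem by (auto simp: set_copies)
    have "v < k" "v' < k" using ws[OF e(2)] us[OF e'(2)] by auto
    with e(1) e'(1) have "a = b" by (simp add: code_eq_iff)
    with es[OF in_es] show False by simp
  qed
  ultimately show ?case
    using Suc.IH[OF i] assms(2,3) by (auto simp: ab distinct_copies)
qed simp

end

section \<open>The program\<close>

text \<open>
  Registers: 0 start of the output, 1 the constant one, 2 the number of vertices, 3 the number of
  edges still to be read, 4 read position, 5 write position, 6 number of edges written, 7 and 8 the
  endpoints of the current edge times \<open>k\<close>, 9 scratch, 10 and 12 the endpoints, 11 start of an array of
  marks (one per vertex, placed between input and output), 13 and 14 address and old value of a mark.
  A vertex is marked once its edges from \<open>ws\<close> have been written, so that they are listed only once.
\<close>

definition edge_step :: "nat \<Rightarrow> (nat \<times> nat) list \<Rightarrow> (nat \<times> nat) list \<Rightarrow> ram_prog" where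
  "edge_step k us ws =
    RSeq (RLoad 10 4) (RSeq (RAdd 4 4 1) (RSeq (RLoad 12 4) (RSeq (RAdd 4 4 1)
    (RSeq (mul_const 7 10 k) (RSeq (mul_const 8 12 k)
    (RSeq (RAdd 13 11 10) (RSeq (RLoad 14 13) (RSeq (RStore 13 1) (RSeq (RSub 3 3 1)
    (RSeq (emit 7 8 us) (RIf 14 RSkip (emit 7 7 ws))))))))))))"

text \<open>The mark is read before it is set, so register 14 tells whether an earlier edge has
  marked the vertex. The two emissions write consecutive blocks, which
  \<open>write_list_append\<close> merges.\<close>

lemma runs_edge_step:
  assumes "reg s 1 = 1" and "mem s (reg s 4) = a" and "mem s (Suc (reg s 4)) = b"
    and "reg s 11 + a < reg s 5"
    and new: "new = copies k us a b @ (if mem s (reg s 11 + a) \<noteq> 0 then [] else copies k ws a a)"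
  shows "runs (edge_step k us ws) s (\<lambda>T s'. T \<le> 16 + 2 * k + 9 * length us + 9 * length ws \<and>
    (\<forall>r\<in>{0, 1, 11}. reg s' r = reg s r) \<and> reg s' 3 = reg s 3 - 1 \<and> reg s' 4 = reg s 4 + 2 \<and>
    reg s' 5 = reg s 5 + 2 * length new \<and> reg s' 6 = reg s 6 + length new \<and>
    mem s' = write_list ((mem s)(reg s 11 + a := 1)) (reg s 5) (flatten new))"
proof -
  have *: "flatten (map (\<lambda>(u, v). (u + k * a, v + k * b)) us) = flatten (copies k us a b)" for us a b
    by (simp add: copies_def)
  have len: "length (copies k us a b) = length us" for us a b by (simp add: copies_def)
  show ?thesis
    using assms(1-4) by (simp add: edge_step_def runs_emit * len new write_list_append[symmetric])
qed

definition blowup_prog :: "nat \<Rightarrow> (nat \<times> nat) list \<Rightarrow> (nat \<times> nat) list \<Rightarrow> ram_prog" where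
  "blowup_prog k us ws =
    RSeq (RConst 1 1) (RSeq (RLoad 3 1) (RIf 3
      (RSeq (RLoad 2 0) (RSeq (RConst 4 2) (RSeq (RAdd 11 3 3) (RSeq (RAdd 11 11 4)
      (RSeq (RAdd 0 11 2) (RSeq (RAdd 5 0 4) (RSeq (mul_const 7 2 k) (RSeq (RStore 0 7)
      (RSeq (RWhile 3 (edge_step k us ws)) (RSeq (RAdd 9 0 1) (RStore 9 6)))))))))))
      RSkip))"

lemma runs_blowup_prog_no_edges:
  assumes "xs = [n, 0]"
  shows "runs (blowup_prog k us ws) (ram_init xs) (\<lambda>T s. T \<le> 4 \<and> ram_output s xs)"
  using assms by (simp add: blowup_prog_def ram_init_def ram_output_def less_Suc_eq)

lemma runs_blowup_prog:
  fixes k n :: nat and us ws es :: "(nat \<times> nat) list"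
  assumes xs: "xs = n # length es # flatten es" and "es \<noteq> []"
    and range: "\<And>a b. (a, b) \<in> set es \<Longrightarrow> a < n"
  defines "out \<equiv> blowup k us ws es (length es)"
  shows "runs (blowup_prog k us ws) (ram_init xs) (\<lambda>T s.
    T \<le> 20 + k + length es * (17 + 2 * k + 9 * length us + 9 * length ws) \<and>
    ram_output s (k * n # length out # flatten out))"
proof -
  let ?m = "length es"
  let ?A = "2 * ?m + 2"
  let ?B = "?A + n"
  let ?out = "blowup k us ws es"
  \<comment> \<open>The memory outside the written edge list after \<open>i\<close> edges: the
    input, the marks, and the vertex count at \<open>?B\<close>. The edge count at
    \<open>?B + 1\<close> is known only after the loop and is 0 until then.\<close>
  define base where "base i j = (if j < ?A then xs ! j
    else if j < ?B then of_bool (j - ?A \<in> fst ` set (take i es))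
    else if j = ?B then k * n else 0)" for i j
  define I where "I i s \<longleftrightarrow> reg s 0 = ?B \<and> reg s 1 = 1 \<and> reg s 3 = ?m - i \<and> reg s 4 = 2 + 2 * i \<and>
    reg s 11 = ?A \<and> reg s 5 = ?B + 2 + 2 * length (?out i) \<and> reg s 6 = length (?out i) \<and>
    mem s = write_list (base i) (?B + 2) (flatten (?out i))" for i and s :: ram_state
  let ?body = "16 + 2 * k + 9 * length us + 9 * length ws"
  have step: "reg s 3 \<noteq> 0 \<and> runs (edge_step k us ws) s (\<lambda>T s'. T \<le> ?body \<and> I (Suc i) s')"
    if i: "i < ?m" and inv: "I i s" for i s
  proof -
    obtain a b where ab: "es ! i = (a, b)" by fastforce
    have "(a, b) \<in> set es" using ab i by (metis nth_mem)
    then have a: "a < n" by (rule range)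
    have mem: "mem s = write_list (base i) (?B + 2) (flatten (?out i))"
      using inv by (simp add: I_def)
    have xa: "mem s (2 + 2 * i) = a" "mem s (Suc (2 + 2 * i)) = b"
      using i nth_flatten[OF i] by (simp_all add: mem write_list_def base_def xs ab)
    have mark: "mem s (?A + a) = of_bool (a \<in> fst ` set (take i es))"
      using a by (simp add: mem write_list_def base_def)
    define new where "new = copies k us a b @ (if mem s (?A + a) \<noteq> 0 then [] else copies k ws a a)"
    have out: "?out (Suc i) = ?out i @ new"
      using mark by (cases "a \<in> fst ` set (take i es)") (simp_all add: new_def ab)
    \<comment> \<open>Setting the mark of \<open>a\<close> matches the passage from
      \<open>take i es\<close> to \<open>take (Suc i) es\<close>.\<close>
    have "(base i)(?A + a := 1) = base (Suc i)"
      using a i by (auto simp: base_def fun_eq_iff take_Suc_conv_app_nth ab)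
    then have mem': "write_list ((mem s)(?A + a := 1)) (?B + 2 + 2 * length (?out i)) (flatten new) =
        write_list (base (Suc i)) (?B + 2) (flatten (?out (Suc i)))"
      using a write_list_append[of "base (Suc i)" "?B + 2" "flatten (?out i)" "flatten new"]
      unfolding mem out by (simp add: write_list_upd del: fun_upd_apply)
    have "runs (edge_step k us ws) s (\<lambda>T s'. T \<le> ?body \<and>
        (\<forall>r\<in>{0, 1, 11}. reg s' r = reg s r) \<and> reg s' 3 = reg s 3 - 1 \<and> reg s' 4 = reg s 4 + 2 \<and>
        reg s' 5 = reg s 5 + 2 * length new \<and> reg s' 6 = reg s 6 + length new \<and>
        mem s' = write_list ((mem s)(reg s 11 + a := 1)) (reg s 5) (flatten new))"
    proof (rule runs_edge_step[where a = a and b = b])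
      show "new = copies k us a b @ (if mem s (reg s 11 + a) \<noteq> 0 then [] else copies k ws a a)"
        using inv by (simp add: I_def new_def)
    qed (use inv a xa in \<open>simp_all add: I_def\<close>)
    then have "runs (edge_step k us ws) s (\<lambda>T s'. T \<le> ?body \<and> I (Suc i) s')"
    proof (rule runs_mono, elim conjE, intro conjI)
      fix T :: nat and s' :: ram_state
      assume *: "\<forall>r\<in>{0, 1, 11}. reg s' r = reg s r" "reg s' 3 = reg s 3 - 1" "reg s' 4 = reg s 4 + 2"
        "reg s' 5 = reg s 5 + 2 * length new" "reg s' 6 = reg s 6 + length new"
        "mem s' = write_list ((mem s)(reg s 11 + a := 1)) (reg s 5) (flatten new)"
      have "mem s' = write_list (base (Suc i)) (?B + 2) (flatten (?out (Suc i)))"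
        using *(6) mem' inv by (simp only: I_def)
      then show "I (Suc i) s'"
        unfolding I_def using * inv by (simp add: I_def out del: blowup.simps)
    qed
    with inv i show ?thesis by (simp add: I_def)
  qed
  have stop: "reg s 3 = 0" if "I ?m s" for s using that by (simp add: I_def)
  have loop: "runs (RWhile 3 (edge_step k us ws)) s (\<lambda>T s'. T \<le> ?m * (?body + 1) + 1 \<and> I ?m s')"
    if "I 0 s" for s
    using runs_RWhile[of ?m I 3 "edge_step k us ws" ?body, OF step stop that] by blast
  have final: "ram_output s' (k * n # length out # flatten out)"
    if "I ?m s" "reg s' 0 = ?B" "mem s' = (mem s)(?B + 1 := length out)" for s s' :: ram_state
    using that
    by (auto simp: I_def ram_output_def write_list_def base_def out_def nth_Cons' algebra_simps numeral_2_eq_2)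
  have init: "mem (ram_init xs) 0 = n" "mem (ram_init xs) (Suc 0) = ?m" "reg (ram_init xs) r = 0" for r
    by (simp_all add: ram_init_def xs)
  \<comment> \<open>Memory beyond the input is zero, which is the right state of the marks before
    any edge is read.\<close>
  have base0: "(mem (ram_init xs))(?B := k * n) = base 0"
    by (auto simp: ram_init_def base_def fun_eq_iff xs nth_Cons')
  show ?thesis
    unfolding blowup_prog_def
    using \<open>es \<noteq> []\<close>
  proof (simp add: init, intro runs_mono[OF loop], goal_cases)
    case 1
    show ?case using base0[unfolded mult_2] by (simp add: I_def init mult_2)
  next
    case (2 T s)
    then have "reg s 0 = ?B" "reg s (Suc 0) = 1" "reg s 6 = length out"
      by (simp_all add: I_def out_def)
    moreover have "T \<le> 7 + ?m * (17 + 2 * k + 9 * length us + 9 * length ws)"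
      using 2 by (simp add: algebra_simps)
    ultimately show ?case using 2 by (auto intro!: final[of s])
  qed
qed

section \<open>Numbering the product vertices, size bounds and edgeless hosts\<close>

lemma numbered_arc_iff:
  assumes "pair_graph G" and "bij_betw f (pverts G) A" and "x \<in> pverts G" and "y \<in> pverts G"
  shows "(f x, f y) \<in> (\<lambda>(u, v). (f u, f v)) ` parcs G \<longleftrightarrow> (x, y) \<in> parcs G"
proof
  assume "(f x, f y) \<in> (\<lambda>(u, v). (f u, f v)) ` parcs G"
  then obtain u v where uv: "(u, v) \<in> parcs G" "f x = f u" "f y = f v" by auto
  then have "u \<in> pverts G" "v \<in> pverts G" using assms(1) by (auto simp: pair_graph_iff)
  then have "x = u" "y = v" using assms uv by (auto simp: bij_betw_def dest: inj_onD)
  with uv show "(x, y) \<in> parcs G" by simp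
qed force

lemma bij_betw_code:
  fixes f :: "'a \<Rightarrow> nat" and h :: "'b \<Rightarrow> nat"
  assumes f: "bij_betw f A {..<n}" and h: "bij_betw h B {..<k}"
  shows "bij_betw (\<lambda>(x, u). h u + k * f x) (A \<times> B) {..<k * n}"
proof (rule bij_betwI')
  show "(case p of (x, u) \<Rightarrow> h u + k * f x) = (case q of (x, u) \<Rightarrow> h u + k * f x) \<longleftrightarrow> p = q"
    if p: "p \<in> A \<times> B" and q: "q \<in> A \<times> B" for p q
  proof -
    obtain x u y v where pq: "p = (x, u)" "q = (y, v)" by fastforce
    have "h u < k" "h v < k" using h p q by (auto simp: pq bij_betw_def)
    moreover have "h u = h v \<longleftrightarrow> u = v" "f x = f y \<longleftrightarrow> x = y"
      using p q f h by (auto simp: pq bij_betw_def inj_on_eq_iff)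
    ultimately show ?thesis by (auto simp: pq code_eq_iff)
  qed
  show "(case p of (x, u) \<Rightarrow> h u + k * f x) \<in> {..<k * n}" if "p \<in> A \<times> B" for p
  proof -
    obtain x u where p: "p = (x, u)" by fastforce
    have "h u < k" "f x < n" using f h that by (auto simp: p bij_betw_def)
    then have "h u + k * f x < k * Suc (f x)" "k * Suc (f x) \<le> k * n"
      by (simp, intro mult_le_mono2) simp
    then show ?thesis by (simp add: p)
  qed
  show "\<exists>p\<in>A \<times> B. i = (case p of (x, u) \<Rightarrow> h u + k * f x)" if "i \<in> {..<k * n}" for i
  proof -
    have "0 < k" using that by (cases k) auto
    then have "i mod k \<in> h ` B" using h by (simp add: bij_betw_def)
    moreover have "i div k \<in> f ` A"
      using f that by (simp add: bij_betw_def less_mult_imp_div_less mult.commute)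
    ultimately obtain u x where "u \<in> B" "x \<in> A" "i mod k = h u" "i div k = f x" by auto
    moreover from this have "i = h u + k * f x" by (metis mod_mult_div_eq)
    ultimately show ?thesis by auto
  qed
qed

lemma length_pairs_le_square:
  assumes "distinct hs" and "\<And>u v. (u, v) \<in> set hs \<Longrightarrow> u < k \<and> v < k"
  shows "length hs \<le> k\<^sup>2"
proof -
  have "set hs \<subseteq> {..<k} \<times> {..<k}" using assms(2) by auto
  then have "card (set hs) \<le> card ({..<k} \<times> {..<k})" by (intro card_mono) auto
  then show ?thesis using assms(1) by (simp add: distinct_card power2_eq_square)
qed

text \<open>A \<open>t\<close>-clique in \<open>H\<close> forces an edge if \<open>t \<ge> 2\<close>
  and a vertex if \<open>t = 1\<close>; the target lacks what is forced.\<close>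

lemma no_subgraph_in_edgeless:
  assumes "pair_graph H" and "has_clique H t" and "t \<ge> 1" and "t = 1 \<Longrightarrow> n = 0"
  shows "\<not> contains_subgraph \<lparr>pverts = {..<n :: nat}, parcs = {}\<rparr> H"
proof
  assume "contains_subgraph \<lparr>pverts = {..<n}, parcs = {}\<rparr> H"
  then have "pverts H \<noteq> {} \<Longrightarrow> n \<noteq> 0" and "parcs H = {}"
    by (auto simp: contains_subgraph_def)
  moreover obtain K where K: "is_clique H K" "finite K" "card K = t"
    using assms(2) by (auto simp: has_clique_def)
  moreover from this have "K \<noteq> {}" using assms(3) by auto
  moreover have "card K \<le> 1" if "parcs H = {}"
    using K that by (auto simp: is_clique_def card_le_Suc0_iff_eq)
  ultimately show False using assms(3,4) by (auto simp: is_clique_def)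
qed

lemma clique_arc:
  assumes "is_clique G X" and "card X \<ge> 2"
  obtains x y where "x \<in> X" "y \<in> X" "(x, y) \<in> parcs G"
proof -
  have "finite X" using assms(2) by (metis card.infinite not_numeral_le_zero)
  then have "\<not> (\<forall>x\<in>X. \<forall>y\<in>X. x = y)" using assms(2) card_le_Suc0_iff_eq[of X] by auto
  then show ?thesis using assms(1) that by (auto simp: is_clique_def)
qed

section \<open>Correctness of the blow-up\<close>

text \<open>A host edge \<open>ab\<close> must join \<open>(a, u)\<close> to \<open>(b, v)\<close>
  and also \<open>(a, v)\<close> to \<open>(b, u)\<close>, so \<open>us\<close> contains both
  orientations. Over a single host vertex they would give the same edge, so \<open>ws\<close> keeps
  only one.\<close>

lemma blowup_correct:
  fixes G :: "'a pair_pre_digraph" and H :: "'b pair_pre_digraph"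
  assumes G: "pair_graph G" and H: "pair_graph H" and t: "t \<ge> 2"
    and C: "C \<subseteq> pverts H" "colourable H t C"
      "\<And>f. f \<in> hom H H \<Longrightarrow> \<exists>K. is_clique H K \<and> card K = t \<and> f ` K \<subseteq> C"
    and h: "bij_betw h (pverts H) {..<k}"
    and hs: "(\<lambda>(u, v). (h u, h v)) ` parcs H = set hs \<union> (set hs)\<inverse>" "distinct hs"
      "\<And>u v. (u, v) \<in> set hs \<Longrightarrow> u < v \<and> v < k"
    and f: "bij_betw f (pverts G) {..<n}"
    and es: "(\<lambda>(u, v). (f u, f v)) ` parcs G = set es \<union> (set es)\<inverse>" "distinct es"
      "\<And>a b. (a, b) \<in> set es \<Longrightarrow> a < n \<and> b < n \<and> a \<noteq> b \<and> (b, a) \<notin> set es"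
  defines "us \<equiv> hs @ map prod.swap hs"
    and "ws \<equiv> filter (\<lambda>(u, v). \<not> (u \<in> h ` C \<and> v \<in> h ` C)) hs"
  defines "out \<equiv> blowup k us ws es (length es)"
  defines "B \<equiv> \<lparr>pverts = {..<k * n}, parcs = set out \<union> (set out)\<inverse>\<rparr>"
  shows "pair_graph B" and "encodes (k * n # length out # flatten out) B"
    and "contains_subgraph B H \<longleftrightarrow> has_clique G t"
proof -
  have us: "u < k \<and> v < k" if "(u, v) \<in> set us" for u v
    using that hs(3)[of u v] hs(3)[of v u] by (auto simp: us_def)
  have ws: "u < v \<and> v < k" if "(u, v) \<in> set ws" for u v
    using that hs(3)[of u v] by (auto simp: ws_def)
  have "distinct us"
    using hs(2) by (auto simp: us_def distinct_map dest!: hs(3))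
  moreover have "distinct ws" using hs(2) by (simp add: ws_def)
  ultimately have "distinct out"
    unfolding out_def using es(2,3) us ws by (intro distinct_blowup[where n = n and k = k]) auto
  moreover have "p < k * n \<and> q < k * n \<and> p \<noteq> q \<and> (q, p) \<notin> set out" if "(p, q) \<in> set out" for p q
    using mem_blowupD[OF es(3) us ws] that unfolding out_def by blast
  ultimately show "pair_graph B" and "encodes (k * n # length out # flatten out) B"
    unfolding B_def using encodes_edge_list[of out "k * n"] by blast+
  \<comment> \<open>The host vertices over which copies of \<open>ws\<close> are written. By
    \<open>t \<ge> 2\<close> a clique has an edge, and one endpoint of it is the first coordinate in
    the listed orientation.\<close>
  define D where "D = {x \<in> pverts G. f x \<in> fst ` set es}"
  have D: "X \<inter> D \<noteq> {}" if X: "is_clique G X" "card X = t" for X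
  proof -
    obtain x y where xy: "x \<in> X" "y \<in> X" "(x, y) \<in> parcs G"
      using clique_arc[OF X(1)] X(2) t by blast
    then have "(f x, f y) \<in> set es \<union> (set es)\<inverse>" using es(1) by force
    then have "f x \<in> fst ` set es \<or> f y \<in> fst ` set es" by force
    then show ?thesis using xy X(1) by (auto simp: D_def is_clique_def)
  qed
  have arcs: "(h u + k * f x, h v + k * f y) \<in> parcs B \<longleftrightarrow>
      (u, v) \<in> parcs H \<and> ((x, y) \<in> parcs G \<or> x = y \<and> x \<in> D \<and> \<not> (u \<in> C \<and> v \<in> C))"
    if xy: "x \<in> pverts G" "y \<in> pverts G" and uv: "u \<in> pverts H" "v \<in> pverts H" for x y u v
  proof -
    have lt: "h u < k" "h v < k" using h uv by (auto simp: bij_betw_def)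
    have arc_H: "(h u, h v) \<in> set hs \<union> (set hs)\<inverse> \<longleftrightarrow> (u, v) \<in> parcs H"
      unfolding hs(1)[symmetric] by (rule numbered_arc_iff[OF H h uv])
    have arc_G: "(f x, f y) \<in> set es \<union> (set es)\<inverse> \<longleftrightarrow> (x, y) \<in> parcs G"
      unfolding es(1)[symmetric] by (rule numbered_arc_iff[OF G f xy])
    have hC: "h u' \<in> h ` C \<longleftrightarrow> u' \<in> C" if "u' \<in> pverts H" for u'
      using h by (intro inj_on_image_mem_iff[OF _ that C(1)]) (simp add: bij_betw_def)
    have f_eq: "f x = f y \<longleftrightarrow> x = y"
      using f xy by (auto simp: bij_betw_def inj_on_eq_iff)
    have mem_us: "(h u, h v) \<in> set us \<longleftrightarrow> (u, v) \<in> parcs H" "(h v, h u) \<in> set us \<longleftrightarrow> (u, v) \<in> parcs H"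
      using arc_H by (auto simp: us_def)
    have mem_ws: "(h u, h v) \<in> set ws \<or> (h v, h u) \<in> set ws \<longleftrightarrow>
        (u, v) \<in> parcs H \<and> \<not> (u \<in> C \<and> v \<in> C)"
      using arc_H hC[OF uv(1)] hC[OF uv(2)] by (auto simp: ws_def)
    have out: "(h u' + k * f x', h v' + k * f y') \<in> set out \<longleftrightarrow>
        (f x', f y') \<in> set es \<and> (h u', h v') \<in> set us \<or>
        f x' = f y' \<and> f x' \<in> fst ` set es \<and> (h u', h v') \<in> set ws"
      if "h u' < k" "h v' < k" for u' v' x' y'
      using code_mem_blowup_iff[OF es(3) us ws that order_refl] by (simp add: out_def)
    have "(h u + k * f x, h v + k * f y) \<in> parcs B \<longleftrightarrow>
        (h u + k * f x, h v + k * f y) \<in> set out \<or> (h v + k * f y, h u + k * f x) \<in> set out"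
      by (simp add: B_def)
    also have "\<dots> \<longleftrightarrow> (u, v) \<in> parcs H \<and> ((f x, f y) \<in> set es \<or> (f y, f x) \<in> set es) \<or>
        x = y \<and> f x \<in> fst ` set es \<and> ((h u, h v) \<in> set ws \<or> (h v, h u) \<in> set ws)"
      unfolding out[OF lt] out[OF lt(2,1)] mem_us using f_eq by metis
    also have "\<dots> \<longleftrightarrow> (u, v) \<in> parcs H \<and> (x, y) \<in> parcs G \<or>
        x = y \<and> x \<in> D \<and> (u, v) \<in> parcs H \<and> \<not> (u \<in> C \<and> v \<in> C)"
      unfolding mem_ws using arc_G xy by (simp add: D_def)
    finally show ?thesis by blast
  qed
  show "contains_subgraph B H \<longleftrightarrow> has_clique G t"
  proof (rule blowup_contains_iff[OF G H C D])
    show "bij_betw (\<lambda>(x, u). h u + k * f x) (pverts G \<times> pverts H) (pverts B)"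
      using bij_betw_code[OF f h] by (simp add: B_def)
  qed (use arcs in auto)
qed

section \<open>Assembling the construction and its cost\<close>

theorem theorem2p1:
  shows "\<exists>c. \<forall>(H :: 'b pair_pre_digraph) t.
    pair_graph H \<and> t \<ge> 1 \<and> has_clique H t \<longrightarrow>
    (\<exists>P. \<forall>(G :: 'a pair_pre_digraph) xs.
      pair_graph G \<and> encodes xs G \<longrightarrow>
      (\<exists>T s (Gstar :: nat pair_pre_digraph) ys.
        ram_exec P (ram_init xs) T s \<and>
        T \<le> c * time_bound t (card (pverts G)) (num_edges G) (card (pverts H)) \<and>
        ram_output s ys \<and> pair_graph Gstar \<and> encodes ys Gstar \<and>
        card (pverts Gstar) \<le> card (pverts G) * card (pverts H) \<and>
        (contains_subgraph Gstar H \<longleftrightarrow> has_clique G t)))"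
\<comment> \<open>Here \<open>67 = 21 + 46\<close>. In units of \<open>k\<^sup>2\<close>, the set-up
  \<open>20 + k\<close> costs at most 21 and one host edge at most
  \<open>17 + 2 + 18 + 9 = 46\<close>.\<close>
proof (rule exI[of _ 67], intro allI impI, elim conjE)
  fix H :: "'b pair_pre_digraph" and t :: nat
  assume H: "pair_graph H" and t: "1 \<le> t" and cl: "has_clique H t"
  define k where "k = card (pverts H)"
  obtain h hs where h: "bij_betw h (pverts H) {..<k}"
    and hs: "(\<lambda>(u, v). (h u, h v)) ` parcs H = set hs \<union> (set hs)\<inverse>" "distinct hs"
      "\<And>u v. (u, v) \<in> set hs \<Longrightarrow> u < v \<and> v < k"
    using obtain_numbering[OF H, folded k_def] by metis
  obtain C where C: "C \<subseteq> pverts H" "colourable H t C"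
      "\<And>f. f \<in> hom H H \<Longrightarrow> \<exists>K. is_clique H K \<and> card K = t \<and> f ` K \<subseteq> C"
    using unavoidable_colourable_set[OF H cl] by blast
  have "pverts H \<noteq> {}"
    using cl t by (auto simp: has_clique_def is_clique_def)
  then have k: "1 \<le> k" using H by (simp add: k_def pair_graph_iff Suc_le_eq card_gt_0_iff)
  then have k2: "1 \<le> k\<^sup>2" by simp
  have len: "length hs \<le> k\<^sup>2"
  proof (rule length_pairs_le_square[OF hs(2)])
    show "u < k \<and> v < k" if "(u, v) \<in> set hs" for u v using hs(3)[OF that] by simp
  qed
  define us where "us = hs @ map prod.swap hs"
  define ws where "ws = filter (\<lambda>(u, v). \<not> (u \<in> h ` C \<and> v \<in> h ` C)) hs"
  \<comment> \<open>\<open>P\<close> depends only on \<open>H\<close> and \<open>t\<close>. For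
    \<open>t = 1\<close> it tests whether the host has a vertex: if so, it writes the pattern,
    otherwise it returns the empty input graph.\<close>
  define P where "P = (if t = 1
    then RSeq (RLoad 1 0) (RIf 1 (writes 0 (k # length hs # flatten hs)) RSkip)
    else blowup_prog k us ws)"
  have main: "\<exists>ys (Gstar :: nat pair_pre_digraph).
      runs P (ram_init xs) (\<lambda>T s. T \<le> 67 * time_bound t (card (pverts G)) (num_edges G) k \<and>
        ram_output s ys) \<and>
      pair_graph Gstar \<and> encodes ys Gstar \<and> card (pverts Gstar) \<le> card (pverts G) * k \<and>
      (contains_subgraph Gstar H \<longleftrightarrow> has_clique G t)"
    if G: "pair_graph G" and enc: "encodes xs G" for G :: "'a pair_pre_digraph" and xs
  proof -
    define n where "n = card (pverts G)"
    obtain f es where f: "bij_betw f (pverts G) {..<n}"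
      and es: "(\<lambda>(u, v). (f u, f v)) ` parcs G = set es \<union> (set es)\<inverse>" "distinct es"
        "\<And>a b. (a, b) \<in> set es \<Longrightarrow> a < n \<and> b < n \<and> a \<noteq> b \<and> (b, a) \<notin> set es"
      and m: "length es = num_edges G" and xs: "xs = n # length es # flatten es"
      using encodesE[OF enc G, folded n_def] by metis
    have fin: "finite (pverts G)" using G by (simp add: pair_graph_iff)
    let ?edgeless = "\<lparr>pverts = {..<n}, parcs = {}\<rparr>"
    have edgeless: "pair_graph ?edgeless" "encodes [n, 0] ?edgeless"
      using encodes_edge_list[of "[]" n] by simp_all
    consider (single) "t = 1" "n > 0" | (empty) "t = 1" "n = 0"
      | (no_edges) "t \<ge> 2" "es = []" | (edges) "t \<ge> 2" "es \<noteq> []"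
      using t by fastforce
    then show ?thesis
    proof cases
      case single
      let ?B = "\<lparr>pverts = {..<k}, parcs = set hs \<union> (set hs)\<inverse>\<rparr>"
      let ?ys = "k # length hs # flatten hs"
      have "u < k \<and> v < k \<and> u \<noteq> v \<and> (v, u) \<notin> set hs" if "(u, v) \<in> set hs" for u v
        using hs(3)[OF that] hs(3)[of v u] by auto
      then have B: "pair_graph ?B" "encodes ?ys ?B"
        using encodes_edge_list[OF _ hs(2), of k] by blast+
      have "mem (ram_init xs) 0 = n" "reg (ram_init xs) 0 = 0"
        by (simp_all add: ram_init_def xs)
      then have "runs P (ram_init xs) (\<lambda>T s. T \<le> 67 * time_bound t n (num_edges G) k \<and> ram_output s ?ys)"
        using single
      proof (simp add: P_def del: writes.simps, intro runs_mono[OF runs_writes], goal_cases)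
        case (1 T s)
        \<comment> \<open>\<open>?ys\<close> has \<open>2 * length hs + 2\<close> entries at three
          steps each, plus one closing step. The summand \<open>k\<^sup>2\<close> of
          \<open>time_bound\<close> for \<open>t = 1\<close> pays for this.\<close>
        then have "T = 6 * length hs + 7" by simp
        then have "T + 2 \<le> 67 * time_bound t n (num_edges G) k"
          using len k2 single by (simp add: time_bound_def)
        moreover have "ram_output s ?ys"
          using 1 by (simp add: ram_output_def write_list_def)
        ultimately show ?case using single by simp
      qed
      moreover have "contains_subgraph ?B H"
        unfolding contains_subgraph_def
        using h hs(1) by (intro exI[of _ h]) (force simp: bij_betw_def)
      moreover have "has_clique G t"
      proof -
        obtain x where "x \<in> pverts G" using single fin by (auto simp: n_def card_gt_0_iff)
        then show ?thesis
          using single by (auto simp: has_clique_def is_clique_def intro!: exI[of _ "{x}"])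
      qed
      ultimately show ?thesis
        using B single by (intro exI[of _ ?ys] exI[of _ ?B]) (simp add: n_def)
    next
      case empty
      then have "es = []" using es(3) by (cases es) auto
      then have "runs P (ram_init xs) (\<lambda>T s. T \<le> 67 * time_bound t n (num_edges G) k \<and> ram_output s [n, 0])"
        using empty k2 by (simp add: P_def xs ram_init_def ram_output_def time_bound_def less_Suc_eq)
      moreover have "\<not> has_clique G t"
        using empty fin by (auto simp: n_def has_clique_def is_clique_def)
      moreover have "\<not> contains_subgraph ?edgeless H"
        using no_subgraph_in_edgeless[OF H cl t] empty by blast
      ultimately show ?thesis
        using edgeless k by (intro exI[of _ "[n, 0]"] exI[of _ ?edgeless]) (simp add: n_def)
    next
      case no_edges
      then have "runs P (ram_init xs) (\<lambda>T s. T \<le> 4 \<and> ram_output s [n, 0])"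
        using runs_blowup_prog_no_edges[of xs n k us ws] by (simp add: P_def xs)
      then have "runs P (ram_init xs) (\<lambda>T s. T \<le> 67 * time_bound t n (num_edges G) k \<and> ram_output s [n, 0])"
        using no_edges by (elim runs_mono) (simp add: time_bound_def)
      moreover have "parcs G = {}" using es(1) no_edges by simp
      then have "\<not> has_clique G t"
        using no_edges clique_arc[of G] by (fastforce simp: has_clique_def)
      moreover have "\<not> contains_subgraph ?edgeless H"
        using no_subgraph_in_edgeless[OF H cl t] no_edges by simp
      ultimately show ?thesis
        using edgeless k by (intro exI[of _ "[n, 0]"] exI[of _ ?edgeless]) (simp add: n_def)
    next
      case edges
      let ?out = "blowup k us ws es (length es)"
      let ?ys = "k * n # length ?out # flatten ?out"
      let ?B = "\<lparr>pverts = {..<k * n}, parcs = set ?out \<union> (set ?out)\<inverse>\<rparr>"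
      note correct = blowup_correct[OF G H edges(1) C h hs f es, folded us_def ws_def]
      have "length us \<le> 2 * k\<^sup>2" "length ws \<le> k\<^sup>2"
        using len le_trans[OF length_filter_le len] by (simp_all add: us_def ws_def)
      moreover have "k \<le> k\<^sup>2" by (simp add: power2_eq_square)
      ultimately have body: "17 + 2 * k + 9 * length us + 9 * length ws \<le> 46 * k\<^sup>2"
          and pre: "20 + k \<le> 21 * k\<^sup>2"
        using k2 by linarith+
      have "20 + k + length es * (17 + 2 * k + 9 * length us + 9 * length ws)
          \<le> 21 * k\<^sup>2 * length es + length es * (46 * k\<^sup>2)"
      proof (rule add_mono)
        \<comment> \<open>There is at least one edge, so the set-up cost is absorbed by the term for
          the edges.\<close>
        show "20 + k \<le> 21 * k\<^sup>2 * length es"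
          using pre edges(2) by (cases es) (auto intro: trans_le_add1)
      qed (rule mult_le_mono2[OF body])
      also have "\<dots> = 67 * (k\<^sup>2 * length es)" by simp
      also have "\<dots> \<le> 67 * time_bound t n (num_edges G) k"
        using m by (simp add: time_bound_def)
      finally have "runs P (ram_init xs) (\<lambda>T s. T \<le> 67 * time_bound t n (num_edges G) k \<and> ram_output s ?ys)"
        using runs_mono[OF runs_blowup_prog[OF xs edges(2), of k us ws]] es(3) edges(1)
        by (fastforce simp: P_def)
      with correct show ?thesis
        by (intro exI[of _ ?ys] exI[of _ ?B]) (simp add: n_def mult.commute)
    qed
  qed
  show "\<exists>P. \<forall>(G :: 'a pair_pre_digraph) xs. pair_graph G \<and> encodes xs G \<longrightarrow>
      (\<exists>T s (Gstar :: nat pair_pre_digraph) ys.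
        ram_exec P (ram_init xs) T s \<and>
        T \<le> 67 * time_bound t (card (pverts G)) (num_edges G) (card (pverts H)) \<and>
        ram_output s ys \<and> pair_graph Gstar \<and> encodes ys Gstar \<and>
        card (pverts Gstar) \<le> card (pverts G) * card (pverts H) \<and>
        (contains_subgraph Gstar H \<longleftrightarrow> has_clique G t))"
    using main unfolding runs_def k_def by (intro exI[of _ P]) blast
qed

end
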